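(* Let $G$ be any additive abelian group whose torsion subgroup $\mathrm{Tor}(G)=\{a\in G: a \text{ has finite order}\}$ is cyclic. Let $m$ be an odd positive integer, let $n$ be a positive integer, and let $A_1,\ldots,A_m$ be arbitrary subsets of $G$ with cardinality $n$. Then the elements of each $A_i$ ($1\le i\le m$) can be listed in a suitable order $a_{i1},\ldots,a_{in}$ so that all the sums $\sum_{i=1}^m a_{ij}$ ($1\le j\le n$) are pairwise distinct. In other words, for a certain subset $A_{m+1}$ of $G$ with $|A_{m+1}|=n$, there is a matrix $(a_{ij})_{1\le i\le m+1,\,1\le j\le n}$ such that $\{a_{i1},\ldots,a_{in}\}=A_i$ for all $i=1,\ldots,m+1$ and the column sum $\sum_{i=1}^{m+1}a_{ij}$ vanishes for every $j=1,\ldots,n$. *)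

theory Defs
  imports "HOL-Algebra.Ring" "HOL-Algebra.Elementary_Groups"
begin

text \<open>
  HOL-Algebra's locale \<open>abelian_group\<close> of additive abelian groups lives on ring records;
  only the carrier, \<open>\<zero>\<close> and \<open>\<oplus>\<close> are relevant, and the multiplicative fields are unconstrained.
\<close>

definition torsion :: "('a, 'm) ring_scheme \<Rightarrow> 'a set" where
  "torsion G = {a \<in> carrier G. \<exists>k::nat. k > 0 \<and> [k] \<cdot>\<^bsub>G\<^esub> a = \<zero>\<^bsub>G\<^esub>}"

text \<open>The torsion elements as a subgroup of the additive group, the form \<open>cyclic_group\<close> expects.\<close>

definition torsion_subgroup :: "('a, 'm) ring_scheme \<Rightarrow> ('a, 'm) monoid_scheme" where
  "torsion_subgroup G = (add_monoid G)\<lparr>carrier := torsion G\<rparr>"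

end

(* A group with cyclic torsion behaves on finite sets like a subgroup of the nonzero complex numbers: an
   injective character on a countable subgroup H containing the torsion extends injectively to one more
   element x. If no positive power of x lies in H, send x to a number avoiding countably many values;
   otherwise send it to a d-th root of the value at x^d, d being minimal with x^d in H. The extension is
   then injective because an element of its kernel is torsion and hence already lies in H.

   Write V for the Vandermonde determinant. For finite sequences x_1, ..., x_m of numbers with m odd, the
   signed sum over all tuples (sigma_1, ..., sigma_m) of permutations of V(j -> prod_s x_s(sigma_s j)) is
   n! * prod_s V(x_s): after expanding V over a permutation tau, each s contributes sgn(tau) V(x_s), and
   sgn(tau)^(m+1) = 1. This is nonzero when the terms of each x_s are distinct, so some tuple of
   permutations makes the products distinct. *)

theory Submission
  imports Defs "HOL-Analysis.Complex_Transcendental" "HOL-Analysis.Continuum_Not_Denumerable"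
    "Jordan_Normal_Form.Determinant" "HOL-Algebra.Multiplicative_Group"
begin

section \<open>Vandermonde determinants and their signed sums over tuples of permutations\<close>

definition vandermonde :: "nat \<Rightarrow> (nat \<Rightarrow> 'a :: comm_ring_1) \<Rightarrow> 'a" where
  "vandermonde n x = det (mat n n (\<lambda>(i, j). x i ^ j))"

lemma vandermonde_expand:
  "vandermonde n x = (\<Sum>p | p permutes {0..<n}. signof p * (\<Prod>i = 0..<n. x i ^ p i))"
proof -
  have "(\<Prod>i = 0..<n. mat n n (\<lambda>(i, j). x i ^ j) $$ (i, p i)) = (\<Prod>i = 0..<n. x i ^ p i)"
    if "p permutes {0..<n}" for p
    using permutes_in_image[OF that] by (intro prod.cong) auto
  then show ?thesis
    by (simp add: vandermonde_def det_def)
qed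

text \<open>The left side is the Leibniz expansion of a transposed Vandermonde matrix whose rows,
  that is exponents, are permuted by \<open>\<tau>\<close>; permuting rows multiplies the
  determinant by the sign. This evaluates the factor of each index \<open>s\<close> in the signed
  sum.\<close>

lemma vandermonde_permuted_exponents:
  assumes \<tau>: "\<tau> permutes {0..<n}"
  shows "(\<Sum>p | p permutes {0..<n}. signof p * (\<Prod>i = 0..<n. x (p i) ^ \<tau> i))
    = signof \<tau> * vandermonde n x"
proof -
  define B where "B = mat n n (\<lambda>(i, j). x j ^ i)"
  have B: "B \<in> carrier_mat n n"
    by (simp add: B_def)
  have "transpose_mat B = mat n n (\<lambda>(i, j). x i ^ j)"
    by (auto simp: B_def)
  then have detB: "det B = vandermonde n x"
    using det_transpose[OF B] by (simp add: vandermonde_def)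
  have "(\<Prod>i = 0..<n. mat n n (\<lambda>(i, j). B $$ (\<tau> i, j)) $$ (i, p i)) = (\<Prod>i = 0..<n. x (p i) ^ \<tau> i)"
    if "p permutes {0..<n}" for p
    using permutes_in_image[OF that] permutes_in_image[OF \<tau>] by (intro prod.cong) (auto simp: B_def)
  then have "det (mat n n (\<lambda>(i, j). B $$ (\<tau> i, j)))
      = (\<Sum>p | p permutes {0..<n}. signof p * (\<Prod>i = 0..<n. x (p i) ^ \<tau> i))"
    by (simp add: det_def)
  then show ?thesis
    using det_permute_rows[OF B \<tau>] detB by simp
qed

text \<open>Two equal points give two identical rows. Conversely, a nonzero kernel vector lists the
  coefficients of a nonzero polynomial of degree less than \<open>n\<close> that vanishes at all
  \<open>n\<close> points, which is impossible if these are distinct. No product formula is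
  involved.\<close>

lemma vandermonde_nonzero_iff:
  fixes x :: "nat \<Rightarrow> 'a :: field"
  shows "vandermonde n x \<noteq> 0 \<longleftrightarrow> inj_on x {0..<n}"
proof
  define M where "M = mat n n (\<lambda>(i, j). x i ^ j)"
  have M: "M \<in> carrier_mat n n"
    by (simp add: M_def)
  have V: "vandermonde n x = det M"
    by (simp add: vandermonde_def M_def)
  show "inj_on x {0..<n}" if "vandermonde n x \<noteq> 0"
  proof (rule inj_onI, rule ccontr)
    fix i j
    assume ij: "i \<in> {0..<n}" "j \<in> {0..<n}" "x i = x j" "i \<noteq> j"
    then have "row M i = row M j"
      by (auto simp: M_def)
    then have "det M = 0"
      using det_identical_rows[OF M] ij by auto
    with that V show False
      by simp
  qed
  show "vandermonde n x \<noteq> 0" if inj: "inj_on x {0..<n}"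
  proof
    assume "vandermonde n x = 0"
    then obtain v where v: "v \<in> carrier_vec n" "v \<noteq> 0\<^sub>v n" "M *\<^sub>v v = 0\<^sub>v n"
      using det_0_iff_vec_prod_zero_field[OF M] V by auto
    define p where "p = (\<Sum>j<n. Polynomial.monom (vec_index v j) j)"
    have coeff: "Polynomial.coeff p j = (if j < n then vec_index v j else 0)" for j
      by (simp add: p_def coeff_sum)
    have "p \<noteq> 0"
    proof
      assume "p = 0"
      then have "vec_index v j = 0" if "j < n" for j
        using coeff[of j] that by simp
      with v(1,2) show False
        by (auto simp: vec_eq_iff)
    qed
    have "poly p (x i) = 0" if "i < n" for i
    proof -
      have "poly p (x i) = (\<Sum>j<n. vec_index v j * x i ^ j)"
        by (simp add: p_def poly_sum poly_monom)
      also have "\<dots> = vec_index (M *\<^sub>v v) i"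
        using that v(1) by (auto simp: M_def scalar_prod_def lessThan_atLeast0 mult.commute intro!: sum.cong)
      finally show ?thesis
        using v(3) that by simp
    qed
    then have "x ` {0..<n} \<subseteq> {y. poly p y = 0}"
      by auto
    then have "card (x ` {0..<n}) \<le> card {y. poly p y = 0}"
      by (rule card_mono[OF poly_roots_finite[OF \<open>p \<noteq> 0\<close>]])
    then have "n \<le> card {y. poly p y = 0}"
      by (simp add: card_image[OF inj])
    also have "\<dots> \<le> degree p"
      by (rule card_poly_roots_bound[OF \<open>p \<noteq> 0\<close>])
    \<comment> \<open>With \<open>n \<le> degree p\<close>, the leading coefficient sits at an index
      where \<open>coeff\<close> gives 0.\<close>
    finally have "lead_coeff p = 0"
      using coeff by simp
    with \<open>p \<noteq> 0\<close> show False
      by simp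
  qed
qed

lemma signed_sum_vandermonde:
  fixes x :: "'i \<Rightarrow> nat \<Rightarrow> 'a :: comm_ring_1"
  assumes "finite I" "odd (card I)"
  shows "(\<Sum>\<sigma> \<in> PiE I (\<lambda>_. {p. p permutes {0..<n}}).
      (\<Prod>s\<in>I. signof (\<sigma> s)) * vandermonde n (\<lambda>j. \<Prod>s\<in>I. x s (\<sigma> s j)))
    = of_nat (fact n) * (\<Prod>s\<in>I. vandermonde n (x s))"
proof -
  let ?P = "{p. p permutes {0..<n}}"
  have finP: "finite ?P"
    by (simp add: finite_permutations)
  have sign_power: "signof \<tau> * signof \<tau> ^ card I = (1 :: 'a)" for \<tau>
    using \<open>odd (card I)\<close> by (cases "sign \<tau> = 1") (auto simp: sign_def)
  have "(\<Sum>\<sigma> \<in> PiE I (\<lambda>_. ?P).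
      (\<Prod>s\<in>I. signof (\<sigma> s)) * vandermonde n (\<lambda>j. \<Prod>s\<in>I. x s (\<sigma> s j)))
    = (\<Sum>\<sigma> \<in> PiE I (\<lambda>_. ?P). \<Sum>\<tau>\<in>?P. signof \<tau> *
        (\<Prod>s\<in>I. signof (\<sigma> s) * (\<Prod>i = 0..<n. x s (\<sigma> s i) ^ \<tau> i)))"
    unfolding vandermonde_expand sum_distrib_left prod_power_distrib
    by (subst prod.swap) (simp add: prod.distrib ac_simps)
  \<comment> \<open>For fixed \<open>\<tau>\<close> the summand is a product over \<open>s\<close>
    of terms that depend on \<open>\<sigma> s\<close> alone, so the sum over tuples factors into a
    product of sums over single permutations.\<close>
  also have "\<dots> = (\<Sum>\<tau>\<in>?P. signof \<tau> *
      (\<Prod>s\<in>I. \<Sum>p\<in>?P. signof p * (\<Prod>i = 0..<n. x s (p i) ^ \<tau> i)))"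
    by (subst sum.swap) (simp add: prod_sum_PiE \<open>finite I\<close> finP flip: sum_distrib_left)
  also have "\<dots> = (\<Sum>\<tau>\<in>?P. signof \<tau> * (\<Prod>s\<in>I. signof \<tau> * vandermonde n (x s)))"
    by (intro sum.cong) (simp_all add: vandermonde_permuted_exponents)
  also have "\<dots> = (\<Sum>\<tau>\<in>?P. \<Prod>s\<in>I. vandermonde n (x s))"
    by (simp add: prod.distrib sign_power flip: mult.assoc)
  also have "\<dots> = of_nat (fact n) * (\<Prod>s\<in>I. vandermonde n (x s))"
    by (simp add: card_permutations[OF refl])
  finally show ?thesis .
qed

text \<open>Characteristic zero keeps the factor \<open>fact n\<close> of the signed sum nonzero, so
  some summand is nonzero, and its Vandermonde factor certifies distinctness.\<close>

lemma distinct_products_field: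
  fixes x :: "'i \<Rightarrow> nat \<Rightarrow> 'a :: field_char_0"
  assumes "finite I" "odd (card I)" and inj: "\<And>s. s \<in> I \<Longrightarrow> inj_on (x s) {0..<n}"
  obtains \<sigma> where "\<And>s. s \<in> I \<Longrightarrow> \<sigma> s permutes {0..<n}"
    and "inj_on (\<lambda>j. \<Prod>s\<in>I. x s (\<sigma> s j)) {0..<n}"
proof -
  let ?S = "PiE I (\<lambda>_. {p. p permutes {0..<n}})"
  have "(\<Prod>s\<in>I. vandermonde n (x s)) \<noteq> 0"
    using \<open>finite I\<close> inj by (simp add: vandermonde_nonzero_iff)
  then have "(\<Sum>\<sigma>\<in>?S. (\<Prod>s\<in>I. signof (\<sigma> s)) * vandermonde n (\<lambda>j. \<Prod>s\<in>I. x s (\<sigma> s j))) \<noteq> 0"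
    by (simp add: signed_sum_vandermonde assms)
  then obtain \<sigma> where "\<sigma> \<in> ?S" "vandermonde n (\<lambda>j. \<Prod>s\<in>I. x s (\<sigma> s j)) \<noteq> 0"
    by (metis (no_types, lifting) mult_zero_right sum.neutral)
  then show thesis
    using that by (auto simp: vandermonde_nonzero_iff)
qed

section \<open>Faithful complex characters and their extension by one element\<close>

text \<open>\<open>\<phi>\<close> is a total function constrained only on \<open>H\<close>. That its
  values on \<open>H\<close> are nonzero follows from multiplicativity and the value at the
  unit.\<close>

definition faithful_character :: "('a, 'b) monoid_scheme \<Rightarrow> 'a set \<Rightarrow> ('a \<Rightarrow> complex) \<Rightarrow> bool" where
  "faithful_character G H \<phi> \<longleftrightarrow> subgroup H G \<and> inj_on \<phi> H \<and> \<phi> \<one>\<^bsub>G\<^esub> = 1 \<and>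
    (\<forall>a\<in>H. \<forall>b\<in>H. \<phi> (a \<otimes>\<^bsub>G\<^esub> b) = \<phi> a * \<phi> b)"

context comm_group
begin

abbreviation torsion_elements :: "'a set" where
  "torsion_elements \<equiv> {a \<in> carrier G. \<exists>k::nat. k > 0 \<and> a [^] k = \<one>}"

context
  fixes H \<phi>
  assumes \<phi>: "faithful_character G H \<phi>"
begin

lemma character_subgroup: "subgroup H G"
  and character_one: "\<phi> \<one> = 1"
  and character_mult: "a \<in> H \<Longrightarrow> b \<in> H \<Longrightarrow> \<phi> (a \<otimes> b) = \<phi> a * \<phi> b"
  and character_inj: "inj_on \<phi> H"
  using \<phi> by (auto simp: faithful_character_def)

lemma character_inv:
  assumes "a \<in> H"
  shows "\<phi> (inv a) = inverse (\<phi> a)"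
proof -
  have "\<phi> a * \<phi> (inv a) = 1"
    using assms character_subgroup character_mult[of a "inv a"] character_one
    by (simp add: subgroup.m_inv_closed subgroup.mem_carrier)
  then show ?thesis
    by (metis inverse_unique)
qed

lemma character_nonzero:
  assumes "a \<in> H"
  shows "\<phi> a \<noteq> 0"
proof
  assume "\<phi> a = 0"
  then have "\<phi> (a \<otimes> inv a) = 0"
    using assms character_subgroup by (simp add: character_mult subgroup.m_inv_closed)
  then show False
    using assms character_subgroup character_one by (simp add: subgroup.mem_carrier)
qed

lemma character_eq_one_iff: "a \<in> H \<Longrightarrow> \<phi> a = 1 \<longleftrightarrow> a = \<one>"
  using character_inj character_one character_subgroup
  by (metis inj_on_eq_iff subgroup.one_closed)

lemma character_pow:
  assumes "a \<in> H"
  shows "\<phi> (a [^] (k :: nat)) = \<phi> a ^ k"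
proof (induction k)
  case (Suc k)
  have "a [^] k \<in> H"
    using assms character_subgroup subgroup_int_pow_closed[of H a "int k"] by (simp add: int_pow_int)
  with Suc assms show ?case
    by (simp add: character_mult)
qed (simp add: character_one)

lemma character_int_pow:
  assumes "a \<in> H"
  shows "\<phi> (a [^] (k :: int)) = \<phi> a powi k"
proof -
  have a: "a \<in> carrier G"
    using assms character_subgroup by (simp add: subgroup.mem_carrier)
  have pow: "a [^] (n :: nat) \<in> H" for n
    using assms character_subgroup subgroup_int_pow_closed[of H a "int n"] by (simp add: int_pow_int)
  show ?thesis
    by (cases k rule: int_cases2)
      (use a pow in \<open>simp_all add: int_pow_int int_pow_neg power_int_minus character_inv character_pow assms\<close>)
qed

text \<open>The hypothesis \<open>kernel\<close> says that the homomorphisms \<open>(h, k)\<close>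
  to \<open>h \<otimes> x [^] k\<close> and \<open>(h, k)\<close> to
  \<open>\<phi> h * z powi k\<close> on the product of \<open>H\<close> with the integers have the
  same kernel. One inclusion makes the extension sending \<open>x\<close> to \<open>z\<close> well
  defined, the other makes it injective.\<close>

lemma extend_character:
  assumes x: "x \<in> carrier G" and "z \<noteq> 0"
    and kernel: "\<And>h k. h \<in> H \<Longrightarrow> h \<otimes> x [^] (k :: int) = \<one> \<longleftrightarrow> \<phi> h * z powi k = 1"
    and "countable H"
  obtains H' \<phi>' where "faithful_character G H' \<phi>'" "insert x H \<subseteq> H'" "countable H'"
proof -
  define H' where "H' = (\<lambda>(h, k). h \<otimes> x [^] (k :: int)) ` (H \<times> UNIV)"
  \<comment> \<open>The choice ranges over all representations of \<open>y\<close>;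
    \<open>eq_iff\<close> below shows that they all give the same value.\<close>
  define \<phi>' where "\<phi>' y = (SOME w. \<exists>h\<in>H. \<exists>k::int. y = h \<otimes> x [^] k \<and> w = \<phi> h * z powi k)" for y
  have carr: "h \<in> carrier G" if "h \<in> H" for h
    using that character_subgroup by (simp add: subgroup.mem_carrier)
  \<comment> \<open>Comparing two representations amounts to applying \<open>kernel\<close> to their
    quotient, with parameters \<open>h \<otimes> inv h'\<close> and \<open>k - l\<close>.\<close>
  have eq_iff: "h \<otimes> x [^] k = h' \<otimes> x [^] l \<longleftrightarrow> \<phi> h * z powi k = \<phi> h' * z powi l"
    if "h \<in> H" "h' \<in> H" for h h' and k l :: int
  proof -
    have inv: "inv h' \<in> H" and mult: "h \<otimes> inv h' \<in> H"
      using that character_subgroup by (auto simp: subgroup.m_inv_closed subgroup.m_closed)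
    have "h \<otimes> inv h' \<otimes> x [^] (k - l) = (h \<otimes> x [^] k) \<otimes> inv (h' \<otimes> x [^] l)"
      using that x by (simp add: carr int_pow_diff inv_mult m_ac)
    then have "h \<otimes> x [^] k = h' \<otimes> x [^] l \<longleftrightarrow> h \<otimes> inv h' \<otimes> x [^] (k - l) = \<one>"
      using that x by (metis carr int_pow_closed m_closed inv_closed inv_equality inv_inv r_inv)
    also have "\<dots> \<longleftrightarrow> \<phi> h * inverse (\<phi> h') * z powi (k - l) = 1"
      using that inv by (simp add: kernel[OF mult] character_mult character_inv)
    also have "\<dots> \<longleftrightarrow> \<phi> h * z powi k = \<phi> h' * z powi l"
      using character_nonzero[OF that(2)] \<open>z \<noteq> 0\<close> by (simp add: power_int_diff field_simps)
    finally show ?thesis .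
  qed
  have \<phi>'_eq: "\<phi>' (h \<otimes> x [^] k) = \<phi> h * z powi k" if "h \<in> H" for h and k :: int
  proof -
    have "\<exists>h'\<in>H. \<exists>l::int. h \<otimes> x [^] k = h' \<otimes> x [^] l \<and> \<phi>' (h \<otimes> x [^] k) = \<phi> h' * z powi l"
      unfolding \<phi>'_def by (rule someI[of _ "\<phi> h * z powi k"]) (rule bexI[OF exI[of _ k] that], simp)
    then show ?thesis
      using eq_iff[OF that] by metis
  qed
  have mult_eq: "(h \<otimes> x [^] k) \<otimes> (h' \<otimes> x [^] l) = (h \<otimes> h') \<otimes> x [^] (k + l)"
    if "h \<in> H" "h' \<in> H" for h h' and k l :: int
    using that x by (simp add: carr int_pow_mult m_ac)
  have one: "\<one> \<in> H"
    using character_subgroup by (rule subgroup.one_closed)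
  have memI: "h \<otimes> x [^] k \<in> H'" if "h \<in> H" for h and k :: int
    using that by (auto simp: H'_def)
  have sub: "subgroup H' G"
  proof (rule subgroupI)
    show "H' \<subseteq> carrier G"
      using x carr by (auto simp: H'_def)
    show "H' \<noteq> {}"
      using memI[OF one] by auto
    show "inv a \<in> H'" if a: "a \<in> H'" for a
    proof -
      from a obtain h and k :: int where "h \<in> H" "a = h \<otimes> x [^] k"
        by (auto simp: H'_def)
      moreover from this have "inv a = inv h \<otimes> x [^] (- k)"
        using x by (simp add: carr inv_mult int_pow_neg)
      ultimately show ?thesis
        using memI[of "inv h" "- k"] character_subgroup by (simp add: subgroup.m_inv_closed)
    qed
    show "a \<otimes> b \<in> H'" if ab: "a \<in> H'" "b \<in> H'" for a b
    proof -
      from ab obtain h k h' l where "h \<in> H" "h' \<in> H" "a = h \<otimes> x [^] (k :: int)" "b = h' \<otimes> x [^] (l :: int)"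
        by (auto simp: H'_def)
      then show ?thesis
        using mult_eq memI character_subgroup by (simp add: subgroup.m_closed)
    qed
  qed
  have "faithful_character G H' \<phi>'"
    unfolding faithful_character_def
  proof (intro conjI ballI sub)
    show "inj_on \<phi>' H'"
      by (auto simp: H'_def inj_on_def \<phi>'_eq eq_iff)
    show "\<phi>' \<one> = 1"
      using \<phi>'_eq[OF one, of 0] by (simp add: character_one)
    show "\<phi>' (a \<otimes> b) = \<phi>' a * \<phi>' b" if ab: "a \<in> H'" "b \<in> H'" for a b
    proof -
      from ab obtain h k h' l where "h \<in> H" "h' \<in> H" "a = h \<otimes> x [^] (k :: int)" "b = h' \<otimes> x [^] (l :: int)"
        by (auto simp: H'_def)
      moreover from this have "h \<otimes> h' \<in> H"
        using character_subgroup by (simp add: subgroup.m_closed)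
      ultimately show ?thesis
        using \<open>z \<noteq> 0\<close> by (simp add: mult_eq \<phi>'_eq character_mult power_int_add)
    qed
  qed
  moreover have "insert x H \<subseteq> H'"
    using memI[of _ 0] memI[OF one, of 1] x carr by auto
  moreover have "countable H'"
    using \<open>countable H\<close> by (simp add: H'_def)
  ultimately show thesis
    by (rule that)
qed

text \<open>It suffices to find a value \<open>z\<close> for \<open>x\<close> that satisfies the
  kernel condition of \<open>extend_character\<close>. Countability of \<open>H\<close> matters when
  no positive power of \<open>x\<close> lies in \<open>H\<close>, the torsion hypothesis when some
  power does.\<close>

lemma extend_character_by_element:
  assumes x: "x \<in> carrier G" and "countable H"
    and torsion: "torsion_elements \<subseteq> H"
  obtains H' \<phi>' where "faithful_character G H' \<phi>'" "insert x H \<subseteq> H'" "countable H'"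
proof -
  have carr: "h \<in> carrier G" if "h \<in> H" for h
    using that character_subgroup by (simp add: subgroup.mem_carrier)
  have pow_in: "x [^] k \<in> H" if "h \<in> H" "h \<otimes> x [^] k \<in> H" for h and k :: int
  proof -
    have "x [^] k = inv h \<otimes> (h \<otimes> x [^] k)"
      using that x carr by (simp flip: m_assoc)
    then show ?thesis
      using that character_subgroup by (metis subgroup.m_closed subgroup.m_inv_closed)
  qed
  have ex: "\<exists>z. z \<noteq> 0 \<and> (\<forall>h\<in>H. \<forall>k::int. h \<otimes> x [^] k = \<one> \<longleftrightarrow> \<phi> h * z powi k = 1)"
  proof (cases "\<exists>d::nat. d > 0 \<and> x [^] d \<in> H")
    case False
    then have no_pow: "x [^] d \<notin> H" if "d > 0" for d :: nat
      using that by blast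
    \<comment> \<open>The forbidden values are 0 and all roots, of every positive order, of values
      of \<open>\<phi>\<close> on \<open>H\<close>. They form a countable union of finite sets, so
      some complex number remains.\<close>
    define bad where "bad = {0} \<union> (\<Union>h\<in>H. \<Union>k\<in>{0<..}. {z::complex. z ^ k = \<phi> h})"
    have "countable {z::complex. z ^ k = \<phi> h}" if "k \<in> {0<..}" for k h
      using that by (intro countable_finite finite_nth_roots) simp
    then have "countable bad"
      unfolding bad_def using \<open>countable H\<close> by (intro countable_Un countable_UN) auto
    then have "bad \<noteq> UNIV"
      using uncountable_UNIV_complex by auto
    then obtain z where z: "z \<notin> bad"
      by auto
    then have nz: "z \<noteq> 0" and no_power: "\<And>h k. h \<in> H \<Longrightarrow> k > 0 \<Longrightarrow> z ^ k \<noteq> \<phi> h"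
      by (auto simp: bad_def)
    have pow_notin: "x [^] k \<notin> H" if "k \<noteq> 0" for k :: int
    proof
      assume "x [^] k \<in> H"
      then have "inv (x [^] k) \<in> H"
        using character_subgroup by (simp add: subgroup.m_inv_closed)
      show False
      proof (cases k rule: int_cases2)
        case (nonneg d)
        then show False
          using no_pow[of d] \<open>x [^] k \<in> H\<close> that by (simp add: int_pow_int)
      next
        case (nonpos d)
        then show False
          using no_pow[of d] \<open>inv (x [^] k) \<in> H\<close> that x by (simp add: int_pow_neg_int)
      qed
    qed
    have "h \<otimes> x [^] k = \<one> \<longleftrightarrow> \<phi> h * z powi k = 1" if h: "h \<in> H" for h and k :: int
    proof (cases "k = 0")
      case True
      then show ?thesis
        using h carr by (simp add: character_eq_one_iff)
    next
      case False
      \<comment> \<open>For \<open>k \<noteq> 0\<close> both sides of the equivalence fail: the left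
        one would put \<open>x [^] k\<close> into \<open>H\<close>, the right one would make a
        positive power of \<open>z\<close> equal to \<open>\<phi> h\<close> or
        \<open>\<phi> (inv h)\<close>.\<close>
      have "h \<otimes> x [^] k \<noteq> \<one>"
        using pow_in[OF h, of k] pow_notin[OF False] character_subgroup by (metis subgroup.one_closed)
      moreover have "\<phi> h * z powi k \<noteq> 1"
      proof
        assume eq: "\<phi> h * z powi k = 1"
        have "inv h \<in> H"
          using h character_subgroup by (simp add: subgroup.m_inv_closed)
        show False
        proof (cases k rule: int_cases2)
          case (nonneg d)
          with eq have "z ^ d = \<phi> (inv h)"
            by (simp add: character_inv[OF h] inverse_unique)
          then show False
            using no_power[OF \<open>inv h \<in> H\<close>, of d] \<open>k \<noteq> 0\<close> nonneg by simp
        next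
          case (nonpos d)
          with eq nz have "z ^ d = \<phi> h"
            by (simp add: power_int_minus field_simps)
          then show False
            using no_power[OF h, of d] \<open>k \<noteq> 0\<close> nonpos by simp
        qed
      qed
      ultimately show ?thesis
        by simp
    qed
    with nz show ?thesis
      by blast
  next
    case True
    define d where "d = (LEAST d::nat. d > 0 \<and> x [^] d \<in> H)"
    have d: "d > 0" "x [^] d \<in> H"
      using LeastI_ex[OF True] by (simp_all add: d_def)
    have d_int: "x [^] (int d * q) \<in> H" for q
      using d(2) x character_subgroup
      by (metis int_pow_int int_pow_pow subgroup_int_pow_closed)
    have dvd: "int d dvd k" if k: "x [^] k \<in> H" for k :: int
    proof -
      \<comment> \<open>Division with remainder: \<open>x [^] r\<close> again lies in
        \<open>H\<close> and \<open>r < d\<close>, so minimality of \<open>d\<close> forces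
        \<open>r = 0\<close>.\<close>
      define r where "r = nat (k mod int d)"
      have r: "int r = k - int d * (k div int d)"
        using d(1) by (simp add: r_def minus_mult_div_eq_mod)
      have "x [^] r = x [^] k \<otimes> inv (x [^] (int d * (k div int d)))"
        using x by (metis int_pow_diff int_pow_int r)
      then have "x [^] r \<in> H"
        using k d_int character_subgroup by (simp add: subgroup.m_closed subgroup.m_inv_closed)
      moreover have "r < d"
        using d(1) by (simp add: r_def nat_less_iff)
      ultimately have "r = 0"
        using not_less_Least[of r "\<lambda>d. d > 0 \<and> x [^] d \<in> H"] by (auto simp: d_def)
      with d(1) r show ?thesis
        by (metis diff_eq_diff_eq dvd_triv_left eq_iff_diff_eq_0 of_nat_0)
    qed
    \<comment> \<open>With this root, \<open>z powi k\<close> agrees with \<open>\<phi>\<close> on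
      every power of \<open>x\<close> in \<open>H\<close>, since these are exactly the powers of
      \<open>x [^] d\<close>.\<close>
    obtain z where z: "\<phi> (x [^] d) = z ^ d"
      using exists_complex_root[of d] d(1) by blast
    have nz: "z \<noteq> 0"
      using character_nonzero[OF d(2)] d(1) z by auto
    have char_pow: "\<phi> (x [^] k) = z powi k" if k: "x [^] k \<in> H" for k :: int
    proof -
      obtain q where q: "k = int d * q"
        using dvd[OF k] by auto
      have "x [^] k = (x [^] d) [^] q"
        using x q by (metis int_pow_int int_pow_pow)
      then show ?thesis
        using character_int_pow[OF d(2), of q] z q by (simp add: power_int_mult)
    qed
    have char_mult: "\<phi> (h \<otimes> x [^] k) = \<phi> h * z powi k"
      if "h \<in> H" "h \<otimes> x [^] k \<in> H" for h and k :: int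
      using that pow_in[OF that] by (simp add: character_mult char_pow)
    have "h \<otimes> x [^] k = \<one> \<longleftrightarrow> \<phi> h * z powi k = 1" if h: "h \<in> H" for h and k :: int
    proof
      assume eq: "h \<otimes> x [^] k = \<one>"
      then have "h \<otimes> x [^] k \<in> H"
        using character_subgroup by (simp add: subgroup.one_closed)
      with h eq show "\<phi> h * z powi k = 1"
        using char_mult character_one by metis
    next
      assume eq: "\<phi> h * z powi k = 1"
      \<comment> \<open>Although \<open>?y\<close> need not lie in \<open>H\<close> a priori, its
        \<open>d\<close>-th power does and has character value 1, hence is the unit. So
        \<open>?y\<close> is torsion and lies in \<open>H\<close>, where \<open>\<phi>\<close> is
        already injective.\<close>
      let ?y = "h \<otimes> x [^] k"
      have y: "?y \<in> carrier G"
        using h x carr by simp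
      have y_pow: "?y [^] d = h [^] d \<otimes> x [^] (int d * k)"
        using h x carr int_pow_pow[OF x, of k "int d"]
        by (simp add: nat_pow_distrib int_pow_int mult.commute)
      have hd: "h [^] d \<in> H"
        using h character_subgroup by (metis int_pow_int subgroup_int_pow_closed)
      have yd: "?y [^] d \<in> H"
        unfolding y_pow using hd d_int character_subgroup by (simp add: subgroup.m_closed)
      have "\<phi> (?y [^] d) = \<phi> h ^ d * z powi (int d * k)"
        using char_mult[OF hd] yd h by (simp add: y_pow character_pow)
      also have "\<dots> = (\<phi> h * z powi k) ^ d"
        by (simp add: power_mult_distrib power_int_power' mult.commute)
      finally have "?y [^] d = \<one>"
        using eq yd by (simp add: character_eq_one_iff)
      then have "?y \<in> H"
        using torsion y d(1) by blast
      with h eq show "?y = \<one>"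
        using char_mult[of h k] by (simp flip: character_eq_one_iff)
    qed
    with nz show ?thesis
      by blast
  qed
  then obtain z where "z \<noteq> 0" "\<And>h k. h \<in> H \<Longrightarrow> h \<otimes> x [^] (k :: int) = \<one> \<longleftrightarrow> \<phi> h * z powi k = 1"
    by blast
  with extend_character[OF x] \<open>countable H\<close> that show thesis
    by metis
qed

end

section \<open>Faithful characters on subgroups containing the torsion and a given finite
  set\<close>

text \<open>The trivial character on the unit subgroup is extended by sending \<open>g\<close> to a
  primitive root of unity of order \<open>ord g\<close>; the kernel condition holds because
  \<open>g [^] k\<close> and \<open>z powi k\<close> are both trivial exactly when
  \<open>ord g\<close> divides \<open>k\<close>.\<close>

lemma exists_faithful_character_powers:
  assumes g: "g \<in> carrier G" and ord: "ord g > 0"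
  obtains H \<phi> where "faithful_character G H \<phi>" "range (\<lambda>k::int. g [^] k) \<subseteq> H" "countable H"
proof -
  define z where "z = exp (2 * of_real pi * \<i> / of_nat (ord g))"
  have "z \<noteq> 0"
    by (simp add: z_def)
  have z_pow: "z ^ j = 1 \<longleftrightarrow> ord g dvd j" for j
    using complex_root_unity_eq_1[of "ord g" j] ord
    by (simp add: z_def field_simps flip: exp_of_nat_mult)
  have z_powi: "z powi k = 1 \<longleftrightarrow> int (ord g) dvd k" for k
    by (cases k rule: int_cases2) (auto simp: power_int_minus z_pow)
  have triv: "faithful_character G {\<one>} (\<lambda>_. 1)"
    by (simp add: faithful_character_def triv_subgroup)
  obtain H \<phi> where H: "faithful_character G H \<phi>" "insert g {\<one>} \<subseteq> H" "countable H"
    by (rule extend_character[OF triv g \<open>z \<noteq> 0\<close>]) (auto simp: g z_powi int_pow_eq_id)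
  moreover have "range (\<lambda>k::int. g [^] k) \<subseteq> H"
    using H character_subgroup subgroup_int_pow_closed by auto
  ultimately show thesis
    using that by blast
qed

text \<open>The powers of \<open>g\<close> already cover the torsion, so the elements of
  \<open>S\<close> can be adjoined one at a time. Countability of the subgroup is carried through
  the induction because each extension asks for it.\<close>

lemma exists_faithful_character:
  assumes g: "g \<in> carrier G" "ord g > 0"
    and torsion: "torsion_elements \<subseteq> range (\<lambda>k::int. g [^] k)"
    and S: "finite S" "S \<subseteq> carrier G"
  obtains H \<phi> where "faithful_character G H \<phi>" "S \<subseteq> H"
proof -
  have "\<exists>H \<phi>. faithful_character G H \<phi> \<and> range (\<lambda>k::int. g [^] k) \<union> S \<subseteq> H \<and> countable H"
    using S
  proof (induction S rule: finite_induct)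
    case empty
    then show ?case
      using exists_faithful_character_powers[OF g] by (metis sup_bot_right)
  next
    case (insert x S)
    then obtain H \<phi> where H: "faithful_character G H \<phi>" "range (\<lambda>k::int. g [^] k) \<union> S \<subseteq> H" "countable H"
      by auto
    have "x \<in> carrier G"
      using insert.prems by simp
    moreover have "torsion_elements \<subseteq> H"
      using torsion H(2) by blast
    ultimately obtain H' \<phi>' where "faithful_character G H' \<phi>'" "insert x H \<subseteq> H'" "countable H'"
      using extend_character_by_element[OF H(1) _ H(3)] by blast
    with H(2) show ?case
      by (intro exI[of _ H'] exI[of _ \<phi>']) auto
  qed
  with that show thesis
    by blast
qed

lemma character_finprod:
  assumes "faithful_character G H \<phi>" "finite I" "\<And>i. i \<in> I \<Longrightarrow> f i \<in> H"
  shows "finprod G f I \<in> H \<and> \<phi> (finprod G f I) = (\<Prod>i\<in>I. \<phi> (f i))"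
  using assms(2,3)
proof (induction I rule: finite_induct)
  case empty
  show ?case
    using character_subgroup[OF assms(1)] character_one[OF assms(1)]
    by (simp add: subgroup.one_closed)
next
  case (insert i I)
  have sub: "subgroup H G"
    by (rule character_subgroup[OF assms(1)])
  have "finprod G f (insert i I) = f i \<otimes> finprod G f I"
    using insert.hyps insert.prems subgroup.mem_carrier[OF sub] by (intro finprod_insert) auto
  then show ?case
    using insert character_mult[OF assms(1)] by (simp add: subgroup.m_closed[OF sub])
qed

section \<open>Distinct products in commutative groups with cyclic torsion\<close>

lemma torsion_elements_subgroup: "subgroup torsion_elements G"
proof (rule subgroupI)
  show "a \<otimes> b \<in> torsion_elements"
    if ab: "a \<in> torsion_elements"
      "b \<in> torsion_elements" for a b
  proof -
    from ab obtain k l :: nat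
      where kl: "k > 0" "l > 0" "a [^] k = \<one>" "b [^] l = \<one>" "a \<in> carrier G" "b \<in> carrier G"
      by auto
    have "a [^] (k * l) = \<one>" "b [^] (k * l) = \<one>"
      using kl by (metis mult.commute nat_pow_one nat_pow_pow)+
    then have "(a \<otimes> b) [^] (k * l) = \<one>"
      using kl by (simp add: nat_pow_distrib)
    then show ?thesis
      using kl by (auto intro!: exI[of _ "k * l"])
  qed
  show "inv a \<in> torsion_elements"
    if "a \<in> torsion_elements" for a
    using that by (auto simp: nat_pow_inv)
  have "\<one> \<in> torsion_elements"
    by (auto intro!: exI[of _ "1::nat"])
  then show "torsion_elements \<noteq> {}"
    by blast
qed auto

text \<open>All entries lie in the domain of one faithful character, whose values are permuted by
  the field version. Equal products in the group would have equal images, so distinctness pulls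
  back.\<close>

lemma distinct_products:
  fixes e :: "'i \<Rightarrow> nat \<Rightarrow> 'a"
  assumes cyclic: "cyclic_group (G\<lparr>carrier := torsion_elements\<rparr>)"
    and I: "finite I" "odd (card I)"
    and inj: "\<And>s. s \<in> I \<Longrightarrow> inj_on (e s) {0..<n}"
    and carr: "\<And>s j. s \<in> I \<Longrightarrow> j < n \<Longrightarrow> e s j \<in> carrier G"
  obtains \<sigma> where "\<And>s. s \<in> I \<Longrightarrow> \<sigma> s permutes {0..<n}"
    and "inj_on (\<lambda>j. \<Otimes>s\<in>I. e s (\<sigma> s j)) {0..<n}"
proof -
  define T where "T = torsion_elements"
  have T: "subgroup T G"
    unfolding T_def by (rule torsion_elements_subgroup)
  interpret T: group "G\<lparr>carrier := T\<rparr>"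
    by (rule subgroup_imp_group[OF T])
  obtain g where "g \<in> T" "T = range (\<lambda>k::int. g [^]\<^bsub>G\<lparr>carrier := T\<rparr>\<^esub> k)"
    using cyclic T.cyclic_group by (auto simp: T_def)
  then have T_eq: "T = range (\<lambda>k::int. g [^] k)"
    using int_pow_consistent[OF T] by auto
  \<comment> \<open>The order of \<open>g\<close> divides a positive exponent that kills
    \<open>g\<close>, so it is positive.\<close>
  have g: "g \<in> carrier G" and "ord g > 0"
    using \<open>g \<in> T\<close> pow_eq_id[of g] by (auto simp: T_def intro: dvd_pos_nat)
  have tors: "torsion_elements \<subseteq> range (\<lambda>k::int. g [^] k)"
    using T_eq unfolding T_def by (rule equalityD1)
  define S where "S = (\<Union>s\<in>I. e s ` {0..<n})"
  have S: "finite S" "S \<subseteq> carrier G"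
    using I carr by (auto simp: S_def)
  obtain H \<phi> where \<phi>: "faithful_character G H \<phi>" and SH: "S \<subseteq> H"
    using exists_faithful_character[OF g \<open>ord g > 0\<close> tors S] by blast
  have eH: "e s j \<in> H" if "s \<in> I" "j < n" for s j
    using that by (intro subsetD[OF SH[unfolded S_def]] UN_I[of s] imageI) simp_all
  have "inj_on (\<lambda>j. \<phi> (e s j)) {0..<n}" if "s \<in> I" for s
    using comp_inj_on[OF inj[OF that] inj_on_subset[OF character_inj[OF \<phi>]]] eH that
    by (auto simp: comp_def image_subset_iff)
  then obtain \<sigma> where \<sigma>: "\<And>s. s \<in> I \<Longrightarrow> \<sigma> s permutes {0..<n}"
    and inj_\<sigma>: "inj_on (\<lambda>j. \<Prod>s\<in>I. \<phi> (e s (\<sigma> s j))) {0..<n}"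
    using distinct_products_field[OF I, of "\<lambda>s j. \<phi> (e s j)"] by blast
  have hom: "\<phi> (\<Otimes>s\<in>I. e s (\<sigma> s j)) = (\<Prod>s\<in>I. \<phi> (e s (\<sigma> s j)))" if "j < n" for j
  proof -
    have "e s (\<sigma> s j) \<in> H" if "s \<in> I" for s
      using eH permutes_in_image[OF \<sigma>[OF that], of j] \<open>j < n\<close> that by simp
    then show ?thesis
      by (rule conjunct2[OF character_finprod[OF \<phi> I(1)]])
  qed
  have "inj_on (\<lambda>j. \<Otimes>s\<in>I. e s (\<sigma> s j)) {0..<n}"
  proof (rule inj_onI)
    fix i j
    assume ij: "i \<in> {0..<n}" "j \<in> {0..<n}" "(\<Otimes>s\<in>I. e s (\<sigma> s i)) = (\<Otimes>s\<in>I. e s (\<sigma> s j))"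
    then have "(\<Prod>s\<in>I. \<phi> (e s (\<sigma> s i))) = (\<Prod>s\<in>I. \<phi> (e s (\<sigma> s j)))"
      using hom[of i] hom[of j] by simp
    then show "i = j"
      by (rule inj_onD[OF inj_\<sigma> _ ij(1,2)])
  qed
  with \<sigma> show thesis
    by (rule that)
qed

end

section \<open>Transfer to additive notation and to matrices indexed from 1\<close>

theorem theorem1p1:
  fixes G :: "('a, 'm) ring_scheme" (structure)
    and m n :: nat
    and A :: "nat \<Rightarrow> 'a set"
  assumes "abelian_group G"
    and "cyclic_group (torsion_subgroup G)"
    and "odd m"
    and "n > 0"
    and "\<And>i. i \<in> {1..m} \<Longrightarrow> A i \<subseteq> carrier G \<and> card (A i) = n"
  shows "(\<exists>a :: nat \<Rightarrow> nat \<Rightarrow> 'a.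
            (\<forall>i\<in>{1..m}. bij_betw (a i) {1..n} (A i)) \<and>
            inj_on (\<lambda>j. \<Oplus>i\<in>{1..m}. a i j) {1..n})
       \<and> (\<exists>B a. B \<subseteq> carrier G \<and> card B = n \<and>
            (\<forall>i\<in>{1..m + 1}. a i ` {1..n} = (A(m + 1 := B)) i) \<and>
            (\<forall>j\<in>{1..n}. (\<Oplus>i\<in>{1..m + 1}. a i j) = \<zero>))"
proof -
  interpret abelian_group G by fact
  \<comment> \<open>Positivity of \<open>n\<close> makes \<open>A i\<close> finite, since
    \<open>card\<close> is 0 on infinite sets.\<close>
  have "\<exists>f. bij_betw f {0..<n} (A i)" if "i \<in> {1..m}" for i
    using assms(4) assms(5)[OF that] ex_bij_betw_nat_finite[of "A i"] card_ge_0_finite by metis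
  then obtain e where e: "\<And>i. i \<in> {1..m} \<Longrightarrow> bij_betw (e i) {0..<n} (A i)"
    by metis
  have e_carr: "e i j \<in> carrier G" if "i \<in> {1..m}" "j < n" for i j
    using bij_betwE[OF e[OF that(1)]] assms(5)[OF that(1)] that(2) by auto
  have cyc: "cyclic_group (add_monoid G\<lparr>carrier := {a \<in> carrier (add_monoid G).
      \<exists>k::nat. k > 0 \<and> a [^]\<^bsub>add_monoid G\<^esub> k = \<one>\<^bsub>add_monoid G\<^esub>}\<rparr>)"
    using assms(2) by (simp add: torsion_subgroup_def torsion_def add_pow_def)
  obtain \<sigma> where \<sigma>: "\<And>i. i \<in> {1..m} \<Longrightarrow> \<sigma> i permutes {0..<n}"
    and inj_\<sigma>: "inj_on (\<lambda>j. \<Oplus>i\<in>{1..m}. e i (\<sigma> i j)) {0..<n}"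
    by (rule comm_group.distinct_products[OF a_comm_group cyc, of "{1..m}" e n])
      (use \<open>odd m\<close> e e_carr in \<open>auto simp: bij_betw_def finsum_def\<close>)
  \<comment> \<open>The shift by one passes from columns \<open>{1..n}\<close> to the range
    \<open>{0..<n}\<close> on which the permutations act.\<close>
  define a where "a = (\<lambda>i j. e i (\<sigma> i (j - 1)))"
  have shift: "bij_betw (\<lambda>j. j - 1) {1..n} {0..<n}"
    by (rule bij_betw_byWitness[where f' = Suc]) auto
  have a_bij: "bij_betw (a i) {1..n} (A i)" if "i \<in> {1..m}" for i
    using bij_betw_trans[OF bij_betw_trans[OF shift permutes_imp_bij[OF \<sigma>[OF that]]] e[OF that]]
    by (simp add: a_def comp_def)
  define s where "s = (\<lambda>j. \<Oplus>i\<in>{1..m}. a i j)"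
  have s_inj: "inj_on s {1..n}"
    using comp_inj_on[of "\<lambda>j. j - 1" "{1..n}" "\<lambda>j. \<Oplus>i\<in>{1..m}. e i (\<sigma> i j)"] shift inj_\<sigma>
    by (simp add: bij_betw_def comp_def s_def a_def)
  have a_carr: "a i j \<in> carrier G" if "i \<in> {1..m}" "j \<in> {1..n}" for i j
    using bij_betwE[OF a_bij[OF that(1)]] assms(5)[OF that(1)] that(2) by auto
  then have s_carr: "s j \<in> carrier G" if "j \<in> {1..n}" for j
    using that by (auto simp: s_def intro!: finsum_closed)
  \<comment> \<open>The extra row consists of the negated column sums; it has \<open>n\<close>
    different entries because the sums are distinct.\<close>
  define B where "B = (\<lambda>j. \<ominus> s j) ` {1..n}"
  define b where "b = a(m + 1 := \<lambda>j. \<ominus> s j)"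
  have "inj_on (\<lambda>j. \<ominus> s j) {1..n}"
  proof (rule inj_onI)
    fix i j
    assume ij: "i \<in> {1..n}" "j \<in> {1..n}" "\<ominus> s i = \<ominus> s j"
    from ij(3) have "\<ominus> (\<ominus> s i) = \<ominus> (\<ominus> s j)"
      by (rule arg_cong)
    then have "s i = s j"
      by (simp only: minus_minus[OF s_carr[OF ij(1)]] minus_minus[OF s_carr[OF ij(2)]])
    then show "i = j"
      by (rule inj_onD[OF s_inj _ ij(1,2)])
  qed
  then have "card B = n"
    by (simp add: B_def card_image)
  moreover have "B \<subseteq> carrier G"
    using s_carr by (auto simp: B_def)
  moreover have "b i ` {1..n} = (A(m + 1 := B)) i" if "i \<in> {1..m + 1}" for i
    using that a_bij[of i] by (cases "i = m + 1") (auto simp: b_def B_def bij_betw_def)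
  moreover have "(\<Oplus>i\<in>{1..m + 1}. b i j) = \<zero>" if j: "j \<in> {1..n}" for j
  proof -
    have "(\<Oplus>i\<in>{1..m}. b i j) = s j"
      unfolding s_def using j a_carr by (intro finsum_cong') (auto simp: b_def)
    moreover have "{1..m + 1} = insert (m + 1) {1..m}"
      by auto
    ultimately have "(\<Oplus>i\<in>{1..m + 1}. b i j) = \<ominus> s j \<oplus> s j"
      using j a_carr s_carr by (simp add: finsum_insert b_def Pi_def)
    then show ?thesis
      using s_carr[OF j] by (simp add: l_neg)
  qed
  ultimately show ?thesis
    using a_bij s_inj unfolding s_def by blast
qed

end
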